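(* For every positive integer $k$ there is a polynomial $P_k(x_1,\dots,x_k)$ with rational coefficients such that for all positive integers $m$ and $n$, \[h_n^{(m)}(k)=\binom{n+m-1}{m-1}\,P_k\!\left(H_{n+m-1}^{(1)}-H_{m-1}^{(1)},\,H_{n+m-1}^{(2)}-H_{m-1}^{(2)},\,\dots,\,H_{n+m-1}^{(k)}-H_{m-1}^{(k)}\right);\] in particular $h_n^{(m)}(k)$ is expressible in terms of ordinary (generalized) harmonic numbers.
   Context: For positive integers $k,m,n$, the generalized hyperharmonic number is \[h_n^{(m)}(k)=\sum_{\substack{1\le n_{m+k-1}<\cdots<n_m\\ \le n_{m-1}\le\cdots\le n_1\le n}}\frac{1}{n_m n_{m+1}\cdots n_{m+k-1}},\] i.e. the sum runs over integers with $1\le n_{m+k-1}<n_{m+k-2}<\cdots<n_m\le n_{m-1}\le\cdots\le n_1\le n$; and $h_n^{(m)}(k)=0$ when $n<k$. For integers $j\ge1$, $N\ge0$, $H_N^{(j)}=\sum_{i=1}^N i^{-j}$ (empty sum $=0$). *)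

theory Defs
  imports Complex_Main "HOL-Library.FuncSet" "HOL-Library.Poly_Mapping"
begin

(* Tuples (n_1, ..., n_(m+k-1)) as extensional functions on {1..m+k-1}, so that each tuple is
   counted once.  The chain decreases weakly up to position m and strictly from there on. *)
definition hyperharm_chains :: "nat \<Rightarrow> nat \<Rightarrow> nat \<Rightarrow> (nat \<Rightarrow> nat) set" where
  "hyperharm_chains m k n =
     {f \<in> {1..m + k - 1} \<rightarrow>\<^sub>E {1..n}.
        (\<forall>i. 1 \<le> i \<and> i < m \<longrightarrow> f (i + 1) \<le> f i) \<and>
        (\<forall>i. m \<le> i \<and> i < m + k - 1 \<longrightarrow> f (i + 1) < f i)}"

definition hyperharm :: "nat \<Rightarrow> nat \<Rightarrow> nat \<Rightarrow> rat" where
  "hyperharm m k n =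
     (\<Sum>f\<in>hyperharm_chains m k n. 1 / (\<Prod>j\<in>{m..m + k - 1}. of_nat (f j)))"

lemma hyperharm_eq_0:
  assumes "m \<ge> 1" "k \<ge> 1" "n < k"
  shows "hyperharm m k n = 0"
proof -
  have False if "f \<in> hyperharm_chains m k n" for f
  proof -
    have rng: "\<And>i. 1 \<le> i \<Longrightarrow> i \<le> m + k - 1 \<Longrightarrow> 1 \<le> f i \<and> f i \<le> n"
      and dec: "\<And>i. m \<le> i \<Longrightarrow> i < m + k - 1 \<Longrightarrow> f (i + 1) < f i"
      using that by (auto simp: hyperharm_chains_def PiE_iff)
    have "f (m + d) + d \<le> n" if "d < k" for d
      using that
    proof (induction d)
      case 0
      then show ?case using rng[of m] assms by simp
    next
      case (Suc d)
      then have "f (m + d + 1) < f (m + d)" by (intro dec) auto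
      then show ?case using Suc by simp
    qed
    moreover have "m + (k - 1) = m + k - 1" using assms by simp
    ultimately have "f (m + k - 1) + (k - 1) \<le> n"
      using assms by (metis diff_less less_le_trans zero_less_one)
    moreover have "1 \<le> f (m + k - 1)" using rng[of "m + k - 1"] assms by linarith
    ultimately show False using assms by linarith
  qed
  then show ?thesis by (auto simp: hyperharm_def intro: sum.neutral)
qed

definition gen_harm :: "nat \<Rightarrow> nat \<Rightarrow> rat" where
  "gen_harm j N = (\<Sum>i=1..N. 1 / of_nat i ^ j)"

(* Multivariate polynomials over the rationals: a monomial is a finitely supported exponent
   vector (variable index to exponent), a polynomial a finitely supported coefficient map. *)
type_synonym rat_mpoly = "(nat \<Rightarrow>\<^sub>0 nat) \<Rightarrow>\<^sub>0 rat"

definition mpoly_vars :: "rat_mpoly \<Rightarrow> nat set" where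
  "mpoly_vars p = (\<Union>\<mu>\<in>Poly_Mapping.keys p. Poly_Mapping.keys \<mu>)"

definition mpoly_eval :: "rat_mpoly \<Rightarrow> (nat \<Rightarrow> rat) \<Rightarrow> rat" where
  "mpoly_eval p x =
     (\<Sum>\<mu>\<in>Poly_Mapping.keys p.
        Poly_Mapping.lookup p \<mu> * (\<Prod>i\<in>Poly_Mapping.keys \<mu>. x i ^ Poly_Mapping.lookup \<mu> i))"

end

theory Submission
  imports Defs "HOL-Computational_Algebra.Formal_Power_Series"
begin

unbundle fps_syntax

text \<open>
  Splitting the chains according to whether the largest entry \<open>n\<^sub>1\<close> equals \<open>n\<close> gives Pascal-type
  recurrences in \<open>m\<close>, \<open>n\<close> and, for \<open>m = 1\<close>, in \<open>k\<close>. Their solution is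
  \<open>binom(n+m-1, m-1) e\<^sub>k(1/m, \<dots>, 1/(n+m-1))\<close> with \<open>e\<^sub>k\<close> the elementary symmetric polynomial, which
  Newton's identities turn into a polynomial in the power sums of \<open>1/m, \<dots>, 1/(n+m-1)\<close>.
\<close>

section \<open>Newton's identities\<close>

text \<open>Generating function of the elementary symmetric polynomials: for finite \<open>A\<close>
  the coefficient at \<open>k\<close> is \<open>e_k\<close> of the family \<open>a\<close> over
  \<open>A\<close>.\<close>

definition esym_fps :: "('b \<Rightarrow> 'a::comm_ring_1) \<Rightarrow> 'b set \<Rightarrow> 'a fps" where
  "esym_fps a A = (\<Prod>i\<in>A. 1 + fps_const (a i) * fps_X)"

lemma esym_fps_empty [simp]: "esym_fps a {} = 1"
  by (simp add: esym_fps_def)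

lemma esym_fps_insert:
  "finite A \<Longrightarrow> j \<notin> A \<Longrightarrow> esym_fps a (insert j A) = (1 + fps_const (a j) * fps_X) * esym_fps a A"
  by (simp add: esym_fps_def)

lemma esym_fps_insert_nth_Suc:
  assumes "finite A" "j \<notin> A"
  shows "esym_fps a (insert j A) $ Suc k = esym_fps a A $ Suc k + a j * esym_fps a A $ k"
  using assms by (simp add: esym_fps_insert distrib_right mult.assoc)

lemma esym_fps_nth_0 [simp]: "esym_fps a A $ 0 = 1"
  by (induction A rule: infinite_finite_induct) (simp_all add: esym_fps_def)

text \<open>The second factor is the logarithmic derivative of \<open>\<Prod>\<^sub>i (1 + a\<^sub>i X)\<close>.\<close>

lemma fps_deriv_esym_fps:
  fixes a :: "'b \<Rightarrow> 'a::comm_ring_1"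
  assumes "finite A"
  shows "fps_deriv (esym_fps a A) =
    esym_fps a A * Abs_fps (\<lambda>j. (-1) ^ j * (\<Sum>i\<in>A. a i ^ Suc j))"
  using assms
proof (induction A)
  case empty
  show ?case by (simp add: fps_eq_iff)
next
  case (insert b A)
  let ?L = "\<lambda>B. Abs_fps (\<lambda>j. (-1) ^ j * (\<Sum>i\<in>B. a i ^ Suc j))"
  let ?G = "Abs_fps (\<lambda>j. (-1) ^ j * a b ^ Suc j)"
  have L: "?L (insert b A) = ?G + ?L A"
    using insert.hyps by (simp add: fps_eq_iff algebra_simps)
  \<comment> \<open>\<open>?G\<close> is the geometric series of \<open>a b / (1 + a b * X)\<close>;
    the identity is kept free of division since the coefficients only form a commutative
    ring.\<close>
  have G: "(1 + fps_const (a b) * fps_X) * ?G = fps_const (a b)"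
  proof (rule fps_ext)
    fix n
    show "((1 + fps_const (a b) * fps_X) * ?G) $ n = fps_const (a b) $ n"
      by (cases n) (simp_all add: distrib_right mult.assoc)
  qed
  have "fps_deriv (esym_fps a (insert b A)) =
      (1 + fps_const (a b) * fps_X) * (esym_fps a A * ?L A) + fps_const (a b) * esym_fps a A"
    using insert by (simp add: esym_fps_insert)
  also have "\<dots> = (1 + fps_const (a b) * fps_X) * esym_fps a A * (?G + ?L A)"
  proof -
    \<comment> \<open>Arbitrary series replace the concrete ones, so that only ring laws are at
      work.\<close>
    have "c * (E * M) + d * E = c * E * (H + M)" if "c * H = d" for c d E H M :: "'a fps"
      unfolding that [symmetric] by (simp add: algebra_simps)
    from this [OF G] show ?thesis .
  qed
  finally show ?case
    using insert.hyps by (simp only: L esym_fps_insert if_True not_False_eq_True)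
qed

text \<open>Compare coefficients at \<open>k\<close> in the formula for the derivative. The index is
  shifted: \<open>j\<close> goes with the power sum of exponent \<open>Suc j\<close>.\<close>

lemma newton_identity:
  assumes "finite A"
  shows "of_nat (Suc k) * esym_fps a A $ Suc k =
    (\<Sum>j\<le>k. esym_fps a A $ (k - j) * ((-1) ^ j * (\<Sum>i\<in>A. a i ^ Suc j)))"
proof -
  have "of_nat (Suc k) * esym_fps a A $ Suc k = fps_deriv (esym_fps a A) $ k"
    by simp
  also have "\<dots> = (\<Sum>j=0..k. ((-1) ^ j * (\<Sum>i\<in>A. a i ^ Suc j)) * esym_fps a A $ (k - j))"
    by (subst fps_deriv_esym_fps [OF assms], subst mult.commute) (simp add: fps_mult_nth)
  finally show ?thesis
    by (simp add: atLeast0AtMost mult.commute)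
qed

section \<open>Polynomial functions\<close>

definition monom_eval :: "(nat \<Rightarrow>\<^sub>0 nat) \<Rightarrow> (nat \<Rightarrow> rat) \<Rightarrow> rat" where
  "monom_eval \<mu> x = (\<Prod>i\<in>Poly_Mapping.keys \<mu>. x i ^ Poly_Mapping.lookup \<mu> i)"

text \<open>Indices outside the support contribute \<open>x i ^ 0 = 1\<close>, so monomials with
  different supports can be compared over one finite set.\<close>

lemma monom_eval_superset:
  assumes "finite S" "Poly_Mapping.keys \<mu> \<subseteq> S"
  shows "monom_eval \<mu> x = (\<Prod>i\<in>S. x i ^ Poly_Mapping.lookup \<mu> i)"
  unfolding monom_eval_def using assms
  by (intro prod.mono_neutral_left) (auto simp: in_keys_iff)

lemma monom_eval_add: "monom_eval (\<mu> + \<nu>) x = monom_eval \<mu> x * monom_eval \<nu> x"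
proof -
  let ?S = "Poly_Mapping.keys \<mu> \<union> Poly_Mapping.keys \<nu>"
  have "monom_eval (\<mu> + \<nu>) x = (\<Prod>i\<in>?S. x i ^ Poly_Mapping.lookup (\<mu> + \<nu>) i)"
    by (intro monom_eval_superset) (use Poly_Mapping.keys_add [of \<mu> \<nu>] in auto)
  also have "\<dots> = (\<Prod>i\<in>?S. x i ^ Poly_Mapping.lookup \<mu> i) * (\<Prod>i\<in>?S. x i ^ Poly_Mapping.lookup \<nu> i)"
    by (simp add: lookup_add power_add prod.distrib)
  finally show ?thesis
    by (simp add: monom_eval_superset [of ?S])
qed

text \<open>Coefficients vanish off the support. For \<open>p + q\<close> the common set matters,
  since cancellation can make the support smaller than the union.\<close>

lemma mpoly_eval_superset:
  assumes "finite S" "Poly_Mapping.keys p \<subseteq> S"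
  shows "mpoly_eval p x = (\<Sum>\<mu>\<in>S. Poly_Mapping.lookup p \<mu> * monom_eval \<mu> x)"
  unfolding mpoly_eval_def monom_eval_def [symmetric] using assms
  by (intro sum.mono_neutral_left) (auto simp: in_keys_iff)

lemma mpoly_eval_add: "mpoly_eval (p + q) x = mpoly_eval p x + mpoly_eval q x"
proof -
  let ?S = "Poly_Mapping.keys p \<union> Poly_Mapping.keys q"
  have "mpoly_eval (p + q) x = (\<Sum>\<mu>\<in>?S. Poly_Mapping.lookup (p + q) \<mu> * monom_eval \<mu> x)"
    by (intro mpoly_eval_superset) (use Poly_Mapping.keys_add [of p q] in auto)
  then show ?thesis
    by (simp add: lookup_add algebra_simps sum.distrib mpoly_eval_superset [of ?S])
qed

lemma mpoly_eval_single: "mpoly_eval (Poly_Mapping.single \<mu> c) x = c * monom_eval \<mu> x"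
  by (simp add: mpoly_eval_def monom_eval_def)

text \<open>Closure properties of this set of functions yield the existence of a polynomial without
  computing its coefficients.\<close>

definition poly_funs :: "nat set \<Rightarrow> ((nat \<Rightarrow> rat) \<Rightarrow> rat) set" where
  "poly_funs V = mpoly_eval ` {p. mpoly_vars p \<subseteq> V}"

lemma poly_funs_monom:
  assumes "Poly_Mapping.keys \<mu> \<subseteq> V"
  shows "(\<lambda>x. c * monom_eval \<mu> x) \<in> poly_funs V"
  unfolding poly_funs_def
proof (rule image_eqI)
  show "(\<lambda>x. c * monom_eval \<mu> x) = mpoly_eval (Poly_Mapping.single \<mu> c)"
    by (simp add: mpoly_eval_single fun_eq_iff)
qed (use assms in \<open>auto simp: mpoly_vars_def split: if_splits\<close>)

lemma poly_funs_const: "(\<lambda>x. c) \<in> poly_funs V"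
  using poly_funs_monom [of 0 V c] by (simp add: monom_eval_def)

lemma poly_funs_var: "i \<in> V \<Longrightarrow> (\<lambda>x. x i) \<in> poly_funs V"
  using poly_funs_monom [of "Poly_Mapping.single i 1" V 1] by (simp add: monom_eval_def)

lemma poly_funs_add:
  assumes "F \<in> poly_funs V" "G \<in> poly_funs V"
  shows "(\<lambda>x. F x + G x) \<in> poly_funs V"
proof -
  obtain p q where "F = mpoly_eval p" "G = mpoly_eval q" "mpoly_vars p \<subseteq> V" "mpoly_vars q \<subseteq> V"
    using assms by (auto simp: poly_funs_def)
  moreover from this have "mpoly_vars (p + q) \<subseteq> V"
    using Poly_Mapping.keys_add [of p q] unfolding mpoly_vars_def by blast
  ultimately show ?thesis
    unfolding poly_funs_def by (intro image_eqI [of _ _ "p + q"]) (auto simp: mpoly_eval_add)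
qed

lemma poly_funs_sum:
  assumes "\<And>i. i \<in> I \<Longrightarrow> F i \<in> poly_funs V"
  shows "(\<lambda>x. \<Sum>i\<in>I. F i x) \<in> poly_funs V"
  using assms
  by (induction I rule: infinite_finite_induct) (auto intro: poly_funs_const poly_funs_add)

text \<open>Expanding both factors gives a double sum of monomials with exponents
  \<open>\<mu> + \<nu>\<close>, so closure under sums suffices.\<close>

lemma poly_funs_mult:
  assumes "F \<in> poly_funs V" "G \<in> poly_funs V"
  shows "(\<lambda>x. F x * G x) \<in> poly_funs V"
proof -
  obtain p q where pq: "F = mpoly_eval p" "G = mpoly_eval q" "mpoly_vars p \<subseteq> V" "mpoly_vars q \<subseteq> V"
    using assms by (auto simp: poly_funs_def)
  have "F x * G x = (\<Sum>\<mu>\<in>Poly_Mapping.keys p. \<Sum>\<nu>\<in>Poly_Mapping.keys q.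
      Poly_Mapping.lookup p \<mu> * Poly_Mapping.lookup q \<nu> * monom_eval (\<mu> + \<nu>) x)" for x
    by (simp add: pq mpoly_eval_def sum_product monom_eval_def [symmetric] monom_eval_add ac_simps)
  moreover have "Poly_Mapping.keys (\<mu> + \<nu>) \<subseteq> V"
    if "\<mu> \<in> Poly_Mapping.keys p" "\<nu> \<in> Poly_Mapping.keys q" for \<mu> \<nu>
    using Poly_Mapping.keys_add [of \<mu> \<nu>] pq(3,4) that unfolding mpoly_vars_def by blast
  ultimately show ?thesis
    by (simp only:) (intro poly_funs_sum poly_funs_monom)
qed

lemma poly_funs_mono: "V \<subseteq> W \<Longrightarrow> poly_funs V \<subseteq> poly_funs W"
  by (auto simp: poly_funs_def)

text \<open>Newton's identity gives \<open>k * e_k\<close> from lower \<open>e_i\<close> and power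
  sums, and \<open>k\<close> can be divided out over the rationals. One \<open>F\<close> serves all
  \<open>A\<close> and \<open>a\<close>; this makes the final polynomial independent of
  \<open>m\<close> and \<open>n\<close>.\<close>

lemma esym_poly_in_power_sums:
  "\<exists>F\<in>poly_funs {1..k}. \<forall>(A :: 'b set) a. finite A \<longrightarrow>
     esym_fps a A $ k = F (\<lambda>j. \<Sum>i\<in>A. a i ^ j)"
proof (induction k rule: less_induct)
  case (less k)
  show ?case
  proof (cases k)
    case 0
    then show ?thesis
      by (intro bexI [of _ "\<lambda>x. 1"] poly_funs_const) simp
  next
    case (Suc l)
    have "\<forall>i\<in>{..l}. \<exists>F. F \<in> poly_funs {1..i} \<and> (\<forall>(A :: 'b set) a. finite A \<longrightarrow>
        esym_fps a A $ i = F (\<lambda>j. \<Sum>i\<in>A. a i ^ j))"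
      using less.IH Suc by (metis atMost_iff le_imp_less_Suc)
    then obtain F where F: "\<And>i. i \<le> l \<Longrightarrow> F i \<in> poly_funs {1..i}"
      and eq: "\<And>i (A :: 'b set) a. i \<le> l \<Longrightarrow> finite A \<Longrightarrow> esym_fps a A $ i = F i (\<lambda>j. \<Sum>i\<in>A. a i ^ j)"
      unfolding bchoice_iff by auto
    \<comment> \<open>Newton's identity solved for the coefficient at \<open>Suc l\<close>, with the
      variable \<open>x (Suc j)\<close> in place of the power sum.\<close>
    let ?G = "\<lambda>x. (1 / of_nat (Suc l)) * (\<Sum>j\<le>l. F (l - j) x * ((-1) ^ j * x (Suc j)))"
    have "F (l - j) \<in> poly_funs {1..k}" for j
      by (rule subsetD [OF poly_funs_mono F]) (use Suc in auto)
    then have "?G \<in> poly_funs {1..k}"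
      using Suc by (intro poly_funs_mult poly_funs_sum poly_funs_const poly_funs_var) auto
    moreover have "esym_fps a A $ k = ?G (\<lambda>j. \<Sum>i\<in>A. a i ^ j)" if "finite A" for A :: "'b set" and a
    proof -
      have "of_nat (Suc l) * esym_fps a A $ Suc l =
          (\<Sum>j\<le>l. F (l - j) (\<lambda>j. \<Sum>i\<in>A. a i ^ j) * ((-1) ^ j * (\<Sum>i\<in>A. a i ^ Suc j)))"
        using newton_identity [OF that, of l a] by (simp only: eq [OF diff_le_self that])
      from this [symmetric] show ?thesis
        unfolding Suc by (simp only:) (simp del: of_nat_Suc)
    qed
    ultimately show ?thesis by (intro bexI [of _ ?G] allI impI)
  qed
qed

section \<open>Recurrences for the generalized hyperharmonic numbers\<close>

lemma finite_hyperharm_chains: "finite (hyperharm_chains m k n)"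
proof (rule finite_subset)
  show "hyperharm_chains m k n \<subseteq> {1..m + k - 1} \<rightarrow>\<^sub>E {1..n}"
    by (auto simp: hyperharm_chains_def)
qed (simp add: finite_PiE)

lemma hyperharm_chains_le_first:
  assumes "f \<in> hyperharm_chains m k n" "1 \<le> i" "i \<le> m + k - 1"
  shows "f i \<le> f 1"
  using assms(2,3)
proof (induction i rule: dec_induct)
  case (step i)
  have "f (Suc i) \<le> f i"
    using assms(1) step.hyps step.prems
    by (cases "i < m") (auto simp: hyperharm_chains_def less_imp_le)
  with step show ?case by simp
qed simp

text \<open>The first entry is the largest, so it alone decides whether the bound \<open>n\<close>
  holds. The hypothesis puts index 1 into the domain, so that \<open>f 1\<close> is a genuine entry
  and not \<open>undefined\<close>.\<close>

lemma hyperharm_chains_first_le: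
  assumes "m + k - 1 \<ge> 1"
  shows "{f \<in> hyperharm_chains m k (Suc n). f 1 \<noteq> Suc n} = hyperharm_chains m k n"
proof (intro set_eqI iffI)
  fix f assume f: "f \<in> {f \<in> hyperharm_chains m k (Suc n). f 1 \<noteq> Suc n}"
  then have "f 1 \<le> n"
    using assms by (auto simp: hyperharm_chains_def PiE_iff le_Suc_eq)
  then have "f i \<le> n" if "1 \<le> i" "i \<le> m + k - 1" for i
    using hyperharm_chains_le_first [of f m k "Suc n" i] f that by simp
  with f show "f \<in> hyperharm_chains m k n"
    by (auto simp: hyperharm_chains_def PiE_iff)
next
  fix f assume f: "f \<in> hyperharm_chains m k n"
  then have "f 1 \<le> n" using assms by (auto simp: hyperharm_chains_def PiE_iff)
  with f show "f \<in> {f \<in> hyperharm_chains m k (Suc n). f 1 \<noteq> Suc n}"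
    by (auto simp: hyperharm_chains_def PiE_iff le_SucI)
qed

lemma hyperharm_Suc:
  assumes "m + k - 1 \<ge> 1"
  shows "hyperharm m k (Suc n) = hyperharm m k n +
    (\<Sum>f | f \<in> hyperharm_chains m k (Suc n) \<and> f 1 = Suc n. 1 / (\<Prod>j\<in>{m..m + k - 1}. of_nat (f j)))"
proof -
  let ?B = "{f \<in> hyperharm_chains m k (Suc n). f 1 = Suc n}"
  have un: "hyperharm_chains m k n \<union> ?B = hyperharm_chains m k (Suc n)"
    and disj: "hyperharm_chains m k n \<inter> ?B = {}"
    using hyperharm_chains_first_le [OF assms, of n] by blast+
  have "finite ?B"
    by (simp add: finite_hyperharm_chains)
  from sum.union_disjoint [OF finite_hyperharm_chains this disj] show ?thesis
    unfolding hyperharm_def by (simp only: un)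
qed

text \<open>Restricting the result keeps it extensional, so that prepending an entry and dropping it
  with \<open>chain_tl\<close> are mutually inverse on chains.\<close>

definition chain_cons :: "nat \<Rightarrow> nat \<Rightarrow> (nat \<Rightarrow> nat) \<Rightarrow> nat \<Rightarrow> nat" where
  "chain_cons l N g = (\<lambda>i\<in>{1..Suc l}. if i = 1 then N else g (i - 1))"

definition chain_tl :: "nat \<Rightarrow> (nat \<Rightarrow> nat) \<Rightarrow> nat \<Rightarrow> nat" where
  "chain_tl l f = (\<lambda>i\<in>{1..l}. f (Suc i))"

lemma chain_cons_tl:
  "f \<in> {1..Suc l} \<rightarrow>\<^sub>E B \<Longrightarrow> f 1 = N \<Longrightarrow> chain_cons l N (chain_tl l f) = f"
  by (rule ext) (auto simp: chain_cons_def chain_tl_def PiE_iff extensional_def restrict_def)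

lemma chain_tl_cons:
  "g \<in> {1..l} \<rightarrow>\<^sub>E B \<Longrightarrow> chain_tl l (chain_cons l N g) = g"
  by (rule ext) (auto simp: chain_cons_def chain_tl_def PiE_iff extensional_def restrict_def)

lemma chain_cons_1: "chain_cons l N g 1 = N"
  by (simp add: chain_cons_def)

text \<open>The equation for \<open>l'\<close> lets the rule apply to domains written as
  \<open>{1..Suc m + k - 1}\<close>.\<close>

lemma chain_cons_PiE:
  assumes "N \<in> B" "\<And>i. i \<in> {1..l} \<Longrightarrow> g i \<in> B" "l' = Suc l"
  shows "chain_cons l N g \<in> {1..l'} \<rightarrow>\<^sub>E B"
proof -
  have "chain_cons l N g i \<in> B" if "i \<in> {1..Suc l}" for i
    using assms(1) assms(2) that by (cases i) (auto simp: chain_cons_def Suc_le_eq)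
  then show ?thesis
    unfolding assms(3) by (auto simp: chain_cons_def)
qed

text \<open>In a chain for \<open>Suc m\<close> the first inequality is weak and the first entry is
  absent from the weight. Dropping an initial \<open>Suc n\<close> thus leaves an arbitrary chain
  for \<open>m\<close> with the same bound and the same weight.\<close>

lemma hyperharm_Suc_Suc:
  assumes "m \<ge> 1" "k \<ge> 1"
  shows "hyperharm (Suc m) k (Suc n) = hyperharm (Suc m) k n + hyperharm m k (Suc n)"
proof -
  let ?l = "m + k - 1"
  let ?S = "{f \<in> hyperharm_chains (Suc m) k (Suc n). f 1 = Suc n}"
  have "(\<Sum>f\<in>?S. 1 / (\<Prod>j\<in>{Suc m..Suc m + k - 1}. of_nat (f j))) = hyperharm m k (Suc n)"
    unfolding hyperharm_def
  proof (rule sum.reindex_bij_witness [of _ "chain_cons ?l (Suc n)" "chain_tl ?l"])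
    fix f assume f: "f \<in> ?S"
    then show "chain_cons ?l (Suc n) (chain_tl ?l f) = f"
      using assms by (intro chain_cons_tl [where B = "{1..Suc n}"]) (auto simp: hyperharm_chains_def)
    show "chain_tl ?l f \<in> hyperharm_chains m k (Suc n)"
      using f assms by (auto simp: hyperharm_chains_def chain_tl_def PiE_iff)
    have "(\<Prod>j\<in>{m..m + k - 1}. of_nat (chain_tl ?l f j)) = (\<Prod>j\<in>{m..m + k - 1}. of_nat (f (Suc j)) :: rat)"
      using assms by (intro prod.cong) (auto simp: chain_tl_def)
    also have "\<dots> = (\<Prod>j\<in>{Suc m..Suc m + k - 1}. of_nat (f j))"
      using assms prod.atLeast_Suc_atMost_Suc_shift [of "\<lambda>j. of_nat (f j) :: rat" m "m + k - 1"]
      by simp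
    finally show "1 / (\<Prod>j\<in>{m..m + k - 1}. of_nat (chain_tl ?l f j)) =
        (1 / (\<Prod>j\<in>{Suc m..Suc m + k - 1}. of_nat (f j)) :: rat)"
      by simp
  next
    fix g assume g: "g \<in> hyperharm_chains m k (Suc n)"
    then show "chain_tl ?l (chain_cons ?l (Suc n) g) = g"
      by (intro chain_tl_cons [where B = "{1..Suc n}"]) (auto simp: hyperharm_chains_def)
    have rng: "1 \<le> g i" "g i \<le> Suc n" if "1 \<le> i" "i \<le> ?l" for i
      using g that by (auto simp: hyperharm_chains_def PiE_iff)
    have weak: "g (Suc i) \<le> g i" if "1 \<le> i" "i < m" for i
      using g that by (auto simp: hyperharm_chains_def)
    have strict: "g (Suc i) < g i" if "m \<le> i" "i < ?l" for i
      using g that by (auto simp: hyperharm_chains_def)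
    have "chain_cons ?l (Suc n) g \<in> {1..Suc m + k - 1} \<rightarrow>\<^sub>E {1..Suc n}"
      using rng assms by (intro chain_cons_PiE) auto
    \<comment> \<open>At \<open>i = 1\<close> this is the range bound on \<open>g 1\<close>;
      elsewhere it is the inequality of \<open>g\<close> one index lower.\<close>
    moreover have "chain_cons ?l (Suc n) g (i + 1) \<le> chain_cons ?l (Suc n) g i"
      if "1 \<le> i \<and> i < Suc m" for i
      using that weak [of "i - 1"] rng [of 1] assms by (cases "i = 1") (auto simp: chain_cons_def)
    moreover have "chain_cons ?l (Suc n) g (i + 1) < chain_cons ?l (Suc n) g i"
      if "Suc m \<le> i \<and> i < Suc m + k - 1" for i
      using that strict [of "i - 1"] assms by (auto simp: chain_cons_def)
    ultimately show "chain_cons ?l (Suc n) g \<in> ?S"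
      by (simp add: hyperharm_chains_def chain_cons_1 del: One_nat_def)
  qed
  then show ?thesis
    using assms by (subst hyperharm_Suc) auto
qed

text \<open>For \<open>m = 1\<close> the first inequality is strict and the first entry belongs to
  the weight: dropping an initial \<open>Suc n\<close> lowers the bound to \<open>n\<close> and
  splits off the factor \<open>1 / of_nat (Suc n)\<close>.\<close>

lemma hyperharm_1_Suc_Suc:
  "hyperharm 1 (Suc k) (Suc n) = hyperharm 1 (Suc k) n + hyperharm 1 k n / of_nat (Suc n)"
proof -
  let ?S = "{f \<in> hyperharm_chains 1 (Suc k) (Suc n). f 1 = Suc n}"
  have "(\<Sum>f\<in>?S. 1 / (\<Prod>j\<in>{1..1 + Suc k - 1}. of_nat (f j))) = hyperharm 1 k n / of_nat (Suc n)"
    unfolding hyperharm_def sum_divide_distrib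
  proof (rule sum.reindex_bij_witness [of _ "chain_cons k (Suc n)" "chain_tl k"])
    fix f assume f: "f \<in> ?S"
    then show "chain_cons k (Suc n) (chain_tl k f) = f"
      by (intro chain_cons_tl [where B = "{1..Suc n}"]) (auto simp: hyperharm_chains_def)
    have dec: "f (Suc i) < f i" if "1 \<le> i" "i \<le> k" for i
      using f that by (auto simp: hyperharm_chains_def)
    have "f (Suc i) \<le> n" if "1 \<le> i" "i \<le> k" for i
      using dec [OF that] hyperharm_chains_le_first [of f 1 "Suc k" "Suc n" i] f that by auto
    then show "chain_tl k f \<in> hyperharm_chains 1 k n"
      using f dec by (auto simp: hyperharm_chains_def chain_tl_def PiE_iff)
    have "(\<Prod>j\<in>{1..1 + k - 1}. of_nat (chain_tl k f j)) = (\<Prod>j\<in>{1..k}. of_nat (f (Suc j)) :: rat)"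
      by (intro prod.cong) (auto simp: chain_tl_def)
    moreover have "(\<Prod>j\<in>{1..1 + Suc k - 1}. of_nat (f j)) =
        of_nat (f 1) * (\<Prod>j\<in>{1..k}. of_nat (f (Suc j)) :: rat)"
      by (simp add: prod.atLeast_Suc_atMost prod.atLeast_Suc_atMost_Suc_shift del: prod.cl_ivl_Suc)
    ultimately show "1 / (\<Prod>j\<in>{1..1 + k - 1}. of_nat (chain_tl k f j)) / of_nat (Suc n) =
        (1 / (\<Prod>j\<in>{1..1 + Suc k - 1}. of_nat (f j)) :: rat)"
      using f by simp
  next
    fix g assume g: "g \<in> hyperharm_chains 1 k n"
    then show "chain_tl k (chain_cons k (Suc n) g) = g"
      by (intro chain_tl_cons [where B = "{1..n}"]) (auto simp: hyperharm_chains_def)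
    have rng: "1 \<le> g i" "g i \<le> n" if "1 \<le> i" "i \<le> k" for i
      using g that by (auto simp: hyperharm_chains_def PiE_iff)
    have strict: "g (Suc i) < g i" if "1 \<le> i" "i < k" for i
      using g that by (auto simp: hyperharm_chains_def)
    have "chain_cons k (Suc n) g \<in> {1..1 + Suc k - 1} \<rightarrow>\<^sub>E {1..Suc n}"
      using rng by (intro chain_cons_PiE) (auto simp: le_SucI)
    moreover have "chain_cons k (Suc n) g (i + 1) < chain_cons k (Suc n) g i"
      if "1 \<le> i \<and> i < 1 + Suc k - 1" for i
      using that strict [of "i - 1"] rng(2) [of 1] by (cases "i = 1") (auto simp: chain_cons_def)
    ultimately show "chain_cons k (Suc n) g \<in> ?S"
      by (simp add: hyperharm_chains_def chain_cons_1 del: One_nat_def)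
  qed
  then show ?thesis
    by (subst hyperharm_Suc) auto
qed

section \<open>Closed form by elementary symmetric polynomials\<close>

lemma hyperharm_1_0: "hyperharm 1 0 n = 1"
proof -
  \<comment> \<open>The index set \<open>{1..0}\<close> is empty, which leaves one chain, and its
    weight is an empty product.\<close>
  have "hyperharm_chains 1 0 n = {\<lambda>x. undefined}"
    by (auto simp: hyperharm_chains_def)
  then show ?thesis by (simp add: hyperharm_def)
qed

text \<open>Both sides satisfy the recurrence of \<open>esym_fps_insert_nth_Suc\<close> with new
  element \<open>Suc n\<close>, and they agree at \<open>n = 0\<close> and at
  \<open>k = 0\<close>.\<close>

lemma hyperharm_1_eq_esym:
  "hyperharm 1 k n = esym_fps (\<lambda>i. 1 / of_nat i) {1..<Suc n} $ k"
proof (induction n arbitrary: k)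
  case 0
  show ?case
    by (cases k) (simp_all add: hyperharm_1_0 [simplified] hyperharm_eq_0)
next
  case (Suc n)
  have "{1..<Suc (Suc n)} = insert (Suc n) {1..<Suc n}" by auto
  then show ?case
    using Suc
    by (cases k) (simp_all add: hyperharm_1_0 hyperharm_1_Suc_Suc
        esym_fps_insert_nth_Suc del: One_nat_def)
qed

text \<open>Outer induction on \<open>m\<close>, inner induction on \<open>n\<close>: the right-hand
  side obeys the recurrence of \<open>hyperharm_Suc_Suc\<close>.\<close>

lemma hyperharm_eq_binomial_esym:
  assumes "m \<ge> 1" "k \<ge> 1"
  shows "hyperharm m k n =
    of_nat ((n + m - 1) choose (m - 1)) * esym_fps (\<lambda>i. 1 / of_nat i) {m..<m + n} $ k"
  using assms(1)
proof (induction m arbitrary: n rule: dec_induct)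
  case base
  then show ?case using hyperharm_1_eq_esym [of k n] by simp
next
  case (step m)
  show ?case
  proof (induction n)
    case 0
    then show ?case using assms by (simp add: hyperharm_eq_0)
  next
    case (Suc n)
    obtain m' k' where m': "m = Suc m'" and k': "k = Suc k'"
      using step.hyps assms by (metis Suc_le_D One_nat_def)
    let ?e = "\<lambda>m n. esym_fps (\<lambda>i. 1 / of_nat i :: rat) {m..<m + n}"
    \<comment> \<open>Both ranges extend the same set, one at the top and one at the bottom, so both
      symmetric polynomials expand over it. Coefficients of \<open>e_k\<close> then match by
      \<open>pascal\<close>, those of \<open>e_(k-1)\<close> by \<open>absorb\<close>.\<close>
    have 1: "{Suc m..<Suc m + Suc n} = insert (Suc (m + n)) {Suc m..<Suc m + n}"
      and 2: "{m..<m + Suc n} = insert m {Suc m..<Suc m + n}"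
      by auto
    have absorb: "of_nat ((n + m + 1) choose m) / of_nat (Suc (m + n)) =
        (of_nat ((n + m) choose (m - 1)) / of_nat m :: rat)"
    proof -
      have "m * ((n + m + 1) choose m) = Suc (m + n) * ((n + m) choose (m - 1))"
        using Suc_times_binomial_eq [of "n + m" m'] by (simp add: m' algebra_simps)
      then have "of_nat m * of_nat ((n + m + 1) choose m) =
          (of_nat (Suc (m + n)) * of_nat ((n + m) choose (m - 1)) :: rat)"
        by (metis of_nat_mult)
      then show ?thesis
        using step.hyps by (simp add: field_simps del: of_nat_Suc)
    qed
    have pascal: "(n + m + 1) choose m = (n + m choose m) + (n + m choose (m - 1))"
      by (simp add: m')
    have "hyperharm (Suc m) k (Suc n) = hyperharm (Suc m) k n + hyperharm m k (Suc n)"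
      using step.hyps assms by (intro hyperharm_Suc_Suc) auto
    also have "\<dots> = of_nat (n + m choose m) * ?e (Suc m) n $ k +
        of_nat (n + m choose (m - 1)) * ?e m (Suc n) $ k"
      using step.hyps by (simp add: Suc step.IH)
    also have "\<dots> = of_nat ((n + m + 1) choose m) * ?e (Suc m) n $ k +
        of_nat ((n + m) choose (m - 1)) / of_nat m * ?e (Suc m) n $ k'"
      unfolding 2 k' pascal by (simp add: esym_fps_insert_nth_Suc algebra_simps)
    also have "\<dots> = of_nat ((n + m + 1) choose m) * ?e (Suc m) (Suc n) $ k"
      unfolding 1 k' absorb [symmetric] by (simp add: esym_fps_insert_nth_Suc algebra_simps)
    finally show ?case by simp
  qed
qed

text \<open>The common initial segment cancels, which leaves the power sums of the numbers
  \<open>1 / i\<close> that occur in the closed form.\<close>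

lemma gen_harm_diff:
  assumes "m \<ge> 1"
  shows "gen_harm j (n + m - 1) - gen_harm j (m - 1) = (\<Sum>i\<in>{m..<m + n}. (1 / of_nat i) ^ j)"
proof -
  have "{1..n + m - 1} = {1..m - 1} \<union> {m..<m + n}" "{1..m - 1} \<inter> {m..<m + n} = {}"
    using assms by auto
  then show ?thesis
    by (simp add: gen_harm_def sum.union_disjoint power_one_over)
qed

theorem theorem2p2:
  fixes k :: nat
  assumes "k \<ge> 1"
  shows "\<exists>P :: rat_mpoly. mpoly_vars P \<subseteq> {1..k} \<and>
    (\<forall>m n :: nat. m \<ge> 1 \<longrightarrow> n \<ge> 1 \<longrightarrow>
       hyperharm m k n =
         of_nat ((n + m - 1) choose (m - 1)) *
         mpoly_eval P (\<lambda>j. gen_harm j (n + m - 1) - gen_harm j (m - 1)))"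
proof -
  \<comment> \<open>\<open>P\<close> is fixed before \<open>m\<close> and \<open>n\<close>; it is
    then used with \<open>A = {m..<m + n}\<close> and \<open>a i = 1 / of_nat i\<close>.\<close>
  obtain P where "mpoly_vars P \<subseteq> {1..k}"
    and "\<And>(A :: nat set) a. finite A \<Longrightarrow> esym_fps a A $ k = mpoly_eval P (\<lambda>j. \<Sum>i\<in>A. a i ^ j)"
    using esym_poly_in_power_sums [of k, where 'b = nat] by (auto simp: poly_funs_def)
  then show ?thesis
    using assms by (intro exI [of _ P]) (simp add: hyperharm_eq_binomial_esym gen_harm_diff
        del: One_nat_def)
qed

end
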